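(* The vector measure $m_{L^1}\colon\mathcal B\to L^1$ has infinite variation over every set $A\in\mathcal B$ satisfying $\mu(A)>0$; that is, $|m_{L^1}|(A)=\infty$ for every such $A$.
   Context: $\mu$ is Lebesgue measure on the Borel $\sigma$-algebra $\mathcal B$ of $(-1,1)$, and $L^p=L^p(\mu)$ (complex-valued functions). The finite Hilbert transform of $f\in L^1$ is $T(f)(t):=\lim_{\varepsilon\to0^+}\frac1\pi\left(\int_{-1}^{t-\varepsilon}+\int_{t+\varepsilon}^1\right)\frac{f(x)}{x-t}\,dx$, which exists for a.e. $t\in(-1,1)$ and is measurable. $T$ maps $L^2$ boundedly into $L^2\subseteq L^1$. $m_{L^1}\colon\mathcal B\to L^1$ is the set function $m_{L^1}(A):=T(\chi_A)$, which is $\sigma$-additive (a vector measure). Its variation $|m_{L^1}|\colon\mathcal B\to[0,\infty]$ is $|m_{L^1}|(A):=\sup\sum_{k=1}^n\|m_{L^1}(A_k)\|_{L^1}$, the supremum being over all finite partitions $\{A_1,\dots,A_n\}$ of $A$ into pairwise disjoint sets from $\mathcal B$. *)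

theory Defs
  imports "HOL-Analysis.Analysis"
begin

definition mu :: "real measure" where
  "mu = restrict_space lborel {-1<..<1}"

text \<open>At the points \<open>t\<close> where the principal value does not exist, \<open>Lim\<close> is an unspecified
  constant; for \<open>f\<close> in \<open>L\<^sup>1\<close> these points form a null set.\<close>

definition finite_hilbert_transform :: "(real \<Rightarrow> complex) \<Rightarrow> real \<Rightarrow> complex" where
  "finite_hilbert_transform f t =
     Lim (at_right 0) (\<lambda>\<epsilon>. of_real (1 / pi) *
       ((LBINT x:{-1<..<t - \<epsilon>}. f x / of_real (x - t)) +
        (LBINT x:{t + \<epsilon><..<1}. f x / of_real (x - t))))"

text \<open>Elements of \<open>L\<^sup>1\<close> are represented by functions; the norm does not distinguish functions
  that agree almost everywhere, and a measurable function is integrable iff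
  it is finite.\<close>

definition L1_norm :: "(real \<Rightarrow> complex) \<Rightarrow> ennreal" where
  "L1_norm f = (\<integral>\<^sup>+ t. ennreal (norm (f t)) \<partial>mu)"

definition m_L1 :: "real set \<Rightarrow> real \<Rightarrow> complex" where
  "m_L1 A = finite_hilbert_transform (indicator A)"

text \<open>The library's \<open>partition_on\<close> excludes empty blocks, which contribute nothing to the sum for
  a set function vanishing on the empty set.\<close>

definition variation ::
    "'a measure \<Rightarrow> ('b \<Rightarrow> ennreal) \<Rightarrow> ('a set \<Rightarrow> 'b) \<Rightarrow> 'a set \<Rightarrow> ennreal" where
  "variation M N m A =
     (SUP P\<in>{P. finite P \<and> P \<subseteq> sets M \<and> partition_on A P}. \<Sum>B\<in>P. N (m B))"

end

theory Submission
  imports Defs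
begin

text \<open>The idea is to cut \<open>A\<close> into the pieces \<open>B\<^sub>k\<close> lying in the \<open>n = 2\<^sup>m\<close> consecutive intervals of
  length \<open>\<delta> = 2 / n\<close> and to evaluate the transform of \<open>B\<^sub>k\<close> only at points \<open>t\<close> to the left of the
  \<open>k\<close>-th interval. There the kernel \<open>1 / (x - t)\<close> is positive on \<open>B\<^sub>k\<close>, so no cancellation
  occurs, and for \<open>t \<in> B\<^sub>l\<close> with \<open>l < k\<close> the transform is at least
  \<open>\<mu> B\<^sub>k / (\<pi> (k - l + 1) \<delta>)\<close>. With \<open>a\<^sub>k = \<mu> B\<^sub>k\<close>, integration over
  the sets \<open>B\<^sub>l\<close> shows that the variation over \<open>A\<close> is at least
  \<open>1 / (\<pi> \<delta>) \<cdot> (\<Sum>l < k. a\<^sub>k a\<^sub>l / (k - l + 1))\<close>, the sum running over all pairs \<open>l < k < n\<close>.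
  This quadratic form is bounded below by the purely combinatorial lemma
  \<open>dyadic_quadratic_form_lower_bound\<close>: twice the sum, together with the diagonal \<open>\<Sum>a\<^sub>k\<^sup>2\<close>, is
  at least \<open>(1 + m / 2) (\<Sum>a\<^sub>k)\<^sup>2 / n\<close>. As \<open>a\<^sub>k \<le> \<delta>\<close>, the diagonal
  is at most \<open>\<delta> \<mu> A\<close>. Hence the lower bound for the variation grows
  linearly in \<open>m\<close>, with slope a multiple of \<open>(\<mu> A)\<^sup>2 > 0\<close>.\<close>

section \<open>A quadratic form with logarithmic growth\<close>

lemma sum_lessThan_add_shift:
  fixes f :: "nat \<Rightarrow> 'a::comm_monoid_add"
  shows "sum f {..<m + n} = sum f {..<m} + (\<Sum>k<n. f (m + k))"
  by (induction n) (simp_all add: add.assoc)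

text \<open>Induction on \<open>m\<close>. Splitting the index range into two halves with sums \<open>L\<close> and \<open>R\<close>, each mixed term has weight
  at least \<open>1 / 2\<^sup>m\<^sup>+\<^sup>1\<close>, which raises the factor \<open>1 + m / 2\<close> by \<open>1 / 2\<close>.\<close>

lemma dyadic_quadratic_form_lower_bound:
  fixes a :: "nat \<Rightarrow> real"
  assumes "\<And>k. a k \<ge> 0"
  shows "(1 + real m / 2) * (\<Sum>k<2^m. a k)\<^sup>2 / 2^m
    \<le> (\<Sum>k<2^m. (a k)\<^sup>2) + 2 * (\<Sum>k<2^m. \<Sum>l<k. a k * a l / (real k - real l + 1))"
  using assms
proof (induction m arbitrary: a)
  case 0
  then show ?case by (simp add: lessThan_Suc)
next
  case (Suc m)
  define N :: nat where "N = 2^m"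
  define b where "b = (\<lambda>k. a (N + k))"
  define L where "L = (\<Sum>k<N. a k)"
  define R where "R = (\<Sum>k<N. b k)"
  define Q where "Q = (\<lambda>c :: nat \<Rightarrow> real. \<Sum>k<N. \<Sum>l<k. c k * c l / (real k - real l + 1))"
  define X where "X = (\<Sum>k<N. \<Sum>l<N. b k * a l / (real (N + k) - real l + 1))"
  define c where "c = 1 + real m / 2"
  have N2: "2 ^ Suc m = N + N" by (simp add: N_def)
  have Npos: "real N > 0" by (simp add: N_def)
  have Nreal: "2 ^ m = real N" "2 ^ Suc m = 2 * real N" by (simp_all add: N_def)
  have left: "c * L\<^sup>2 / N \<le> (\<Sum>k<N. (a k)\<^sup>2) + 2 * Q a"
    using Suc.IH[of a] Suc.prems unfolding L_def Q_def c_def N_def by simp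
  have right: "c * R\<^sup>2 / N \<le> (\<Sum>k<N. (b k)\<^sup>2) + 2 * Q b"
    using Suc.IH[of b] Suc.prems unfolding R_def Q_def c_def N_def b_def by simp
  have split: "(\<Sum>k<N+N. \<Sum>l<k. a k * a l / (real k - real l + 1)) = Q a + X + Q b"
    by (simp add: sum_lessThan_add_shift Q_def X_def b_def sum.distrib)
  have cross: "R * L / (2 * N) \<le> X"
  proof -
    have "R * L / (2 * N) = (\<Sum>k<N. \<Sum>l<N. b k * a l / (2 * N))"
      by (simp add: R_def L_def sum_product sum_divide_distrib)
    also have "\<dots> \<le> X"
      unfolding X_def
    proof (intro sum_mono)
      fix k l assume kl: "k \<in> {..<N}" "l \<in> {..<N}"
      have "0 \<le> b k * a l" using Suc.prems by (simp add: b_def)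
      moreover have "0 < real (N + k) - real l + 1" "real (N + k) - real l + 1 \<le> 2 * N"
        using kl by auto
      ultimately show "b k * a l / (2 * N) \<le> b k * a l / (real (N + k) - real l + 1)"
        by (intro divide_left_mono) (auto intro!: mult_pos_pos)
    qed
    finally show ?thesis .
  qed
  have alg: "(c + 1/2) * (L + R)\<^sup>2 \<le> 2 * c * L\<^sup>2 + 2 * c * R\<^sup>2 + 2 * (R * L)"
  proof -
    have "2 * c * L\<^sup>2 + 2 * c * R\<^sup>2 + 2 * (R * L) - (c + 1/2) * (L + R)\<^sup>2 = (c - 1/2) * (L - R)\<^sup>2"
      by (simp add: power2_eq_square algebra_simps)
    moreover have "0 \<le> (c - 1/2) * (L - R)\<^sup>2" by (simp add: c_def)
    ultimately show ?thesis by linarith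
  qed
  have "(1 + real (Suc m) / 2) * (\<Sum>k<2^Suc m. a k)\<^sup>2 / 2^Suc m = (c + 1/2) * (L + R)\<^sup>2 / (2 * N)"
    unfolding N2 Nreal by (simp add: sum_lessThan_add_shift L_def R_def b_def c_def add_divide_distrib)
  also have "\<dots> \<le> (2 * c * L\<^sup>2 + 2 * c * R\<^sup>2 + 2 * (R * L)) / (2 * N)"
    using alg Npos by (intro divide_right_mono) auto
  also have "\<dots> = c * L\<^sup>2 / N + c * R\<^sup>2 / N + 2 * (R * L / (2 * N))"
    using Npos by (simp add: field_simps)
  also have "\<dots> \<le> ((\<Sum>k<N. (a k)\<^sup>2) + 2 * Q a) + ((\<Sum>k<N. (b k)\<^sup>2) + 2 * Q b) + 2 * X"
    by (intro add_mono mult_left_mono left right cross) simp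
  also have "\<dots> = (\<Sum>k<N+N. (a k)\<^sup>2) + 2 * (Q a + X + Q b)"
    unfolding sum_lessThan_add_shift b_def by simp
  finally show ?case unfolding N2 split .
qed

section \<open>The transform of an indicator function to the left of its support\<close>

text \<open>To the left of \<open>c\<close> no principal value is needed: the truncated integrals are constant for
  small \<open>\<epsilon>\<close>.\<close>

lemma finite_hilbert_transform_indicator_right:
  fixes B :: "real set"
  assumes "B \<subseteq> {c..<1}" and "t < c"
  shows "finite_hilbert_transform (indicator B) t
    = of_real (1 / pi * (LBINT x:B. 1 / (x - t)))"
proof -
  have "(of_real (1 / pi) *
       ((LBINT x:{-1<..<t - \<epsilon>}. indicator B x / of_real (x - t)) +
        (LBINT x:{t + \<epsilon><..<1}. indicator B x / of_real (x - t))) :: complex)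
      = of_real (1 / pi * (LBINT x:B. 1 / (x - t)))" if "0 < \<epsilon>" "\<epsilon> < c - t" for \<epsilon>
  proof -
    have "(LBINT x:{-1<..<t - \<epsilon>}. indicator B x / of_real (x - t)) = (LBINT x::real. (0::complex))"
      unfolding set_lebesgue_integral_def
      using assms that by (intro Bochner_Integration.integral_cong) (auto split: split_indicator)
    moreover have "(LBINT x:{t + \<epsilon><..<1}. indicator B x / of_real (x - t))
        = (LBINT x. (of_real (indicator B x *\<^sub>R (1 / (x - t))) :: complex))"
      unfolding set_lebesgue_integral_def
      using assms that by (intro Bochner_Integration.integral_cong) (auto split: split_indicator)
    then have "(LBINT x:{t + \<epsilon><..<1}. indicator B x / of_real (x - t))
        = (of_real (LBINT x:B. 1 / (x - t)) :: complex)"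
      unfolding set_lebesgue_integral_def integral_complex_of_real .
    ultimately show ?thesis by simp
  qed
  moreover have "eventually (\<lambda>\<epsilon>. 0 < \<epsilon> \<and> \<epsilon> < c - t) (at_right 0)"
    using assms(2) by (auto simp: eventually_at_right_field intro!: exI[of _ "c - t"])
  ultimately show ?thesis
    unfolding finite_hilbert_transform_def
    by (intro tendsto_Lim tendsto_eventually) (auto elim!: eventually_mono)
qed

lemma norm_finite_hilbert_transform_indicator_ge:
  fixes B :: "real set"
  assumes "B \<in> sets borel" and "B \<subseteq> {c..<1}" and "t < c" and "B \<subseteq> {..t + d}" and "0 < d"
  shows "measure lborel B / (pi * d) \<le> norm (finite_hilbert_transform (indicator B) t)"
proof -
  have fin: "emeasure lborel B < \<infinity>"
    using assms(2) by (intro emeasure_bounded_finite bounded_subset[OF bounded_closed_interval[of c 1]]) auto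
  have int: "set_integrable lborel B (\<lambda>x. 1 / (x - t))"
    unfolding set_integrable_def
  proof (rule Bochner_Integration.integrable_bound)
    show "integrable lborel (\<lambda>x. indicator B x *\<^sub>R (1 / (c - t)))"
      using assms(1) fin by (intro integrable_scaleR_left) auto
    show "(\<lambda>x. indicator B x *\<^sub>R (1 / (x - t))) \<in> borel_measurable lborel"
      using assms(1) by measurable
    show "AE x in lborel. norm (indicator B x *\<^sub>R (1 / (x - t))) \<le> norm (indicator B x *\<^sub>R (1 / (c - t)))"
      using assms(2,3) by (intro AE_I2) (auto simp: frac_le split: split_indicator)
  qed
  have "measure lborel B / d = (LBINT x:B. 1 / d)"
    using assms(1) fin by (simp add: set_lebesgue_integral_def)
  also have "\<dots> \<le> (LBINT x:B. 1 / (x - t))"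
  proof (rule set_integral_mono)
    show "set_integrable lborel B (\<lambda>x. 1 / d)"
      using assms(1) fin unfolding set_integrable_def by (intro integrable_scaleR_left) auto
    fix x assume "x \<in> B"
    then have "t < x" "x \<le> t + d" using assms(2,3,4) by force+
    then show "1 / d \<le> 1 / (x - t)" by (intro divide_left_mono) (use assms(5) in auto)
  qed (fact int)
  finally have "measure lborel B / d \<le> \<bar>LBINT x:B. 1 / (x - t)\<bar>" by simp
  then show ?thesis
    unfolding finite_hilbert_transform_indicator_right[OF assms(2,3)] norm_of_real
    by (simp add: abs_mult divide_right_mono field_simps)
qed

section \<open>Lower bounds for the variation\<close>

text \<open>The lower bound for the variation obtained from the partition of \<open>A\<close> into its intersections
  with \<open>n\<close> half-open intervals. The intervals are closed on the left and
  only pairs \<open>l < k\<close> are used, so that a point of the \<open>l\<close>-th piece has positive distance from the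
  \<open>k\<close>-th interval.\<close>

lemma variation_ge_quadratic_form:
  fixes A :: "real set" and n :: nat
  assumes A: "A \<in> sets borel" "A \<subseteq> {-1<..<1}" and n: "n > 0"
  defines "\<delta> \<equiv> 2 / real n"
  defines "B \<equiv> (\<lambda>k::nat. A \<inter> {-1 + real k * \<delta>..< -1 + (real k + 1) * \<delta>})"
  defines "a \<equiv> (\<lambda>k. measure lborel (B k))"
  shows "ennreal (1 / (pi * \<delta>) * (\<Sum>k<n. \<Sum>l<k. a k * a l / (real k - real l + 1)))
      \<le> variation mu L1_norm m_L1 A"
    and "(\<Sum>k<n. a k) = measure lborel A"
    and "a k \<le> \<delta>"
proof -
  have \<delta>: "\<delta> > 0" using n by (simp add: \<delta>_def)
  have Bborel [measurable]: "B k \<in> sets borel" for k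
    using A(1) by (simp add: B_def)
  have Bsub: "B k \<subseteq> A" for k by (auto simp: B_def)
  have Bfin: "emeasure lborel (B k) < \<infinity>" for k
    using Bsub[of k] A(2) by (intro emeasure_bounded_finite bounded_subset[OF bounded_closed_interval[of "-1" 1]]) force
  have Bmu: "B k \<in> sets mu" for k
    unfolding mu_def using A(2) Bsub[of k] by (simp add: sets_restrict_space_iff)
  have emu: "emeasure mu (B k) = ennreal (a k)" for k
    unfolding mu_def a_def using A(2) Bsub[of k] Bfin[of k]
    by (subst emeasure_restrict_space) (auto simp: emeasure_eq_ennreal_measure)
  have order: "s < x" if "s \<in> B l" "x \<in> B k" "l < k" for s x k l
  proof -
    have "(real l + 1) * \<delta> \<le> real k * \<delta>" using that(3) \<delta> by (intro mult_right_mono) auto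
    then show ?thesis using that(1,2) by (auto simp: B_def)
  qed
  have disj: "k = l" if "x \<in> B k" "x \<in> B l" for x k l
    using order[of x l x k] order[of x k x l] that by (metis less_irrefl linorder_neqE_nat)
  have cover: "\<exists>k<n. x \<in> B k" if "x \<in> A" for x
  proof -
    have x: "-1 < x" "x < 1" using that A(2) by auto
    define k where "k = nat \<lfloor>(x + 1) / \<delta>\<rfloor>"
    have "0 \<le> (x + 1) / \<delta>" using x \<delta> by simp
    then have k: "real k \<le> (x + 1) / \<delta>" "(x + 1) / \<delta> < real k + 1"
      unfolding k_def by linarith+
    then have "real k * \<delta> \<le> x + 1" "x + 1 < (real k + 1) * \<delta>"
      using \<delta> by (simp_all add: field_simps)
    then have "x \<in> B k" using that by (simp add: B_def)
    moreover have "(x + 1) / \<delta> < real n" using x n by (simp add: \<delta>_def field_simps)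
    then have "k < n" using k by linarith
    ultimately show ?thesis by blast
  qed
  have UB: "(\<Union>k<n. B k) = A" using cover Bsub by blast
  show "(\<Sum>k<n. a k) = measure lborel A"
    unfolding a_def UB[symmetric] using disj Bfin
    by (intro measure_finite_Union[symmetric]) (auto simp: disjoint_family_on_def image_subset_iff less_top)
  show "a k \<le> \<delta>"
  proof -
    have "{-1 + real k * \<delta>..< -1 + (real k + 1) * \<delta>} \<in> fmeasurable lborel"
      by (intro fmeasurableI emeasure_bounded_finite) auto
    then have "a k \<le> measure lborel {-1 + real k * \<delta>..< -1 + (real k + 1) * \<delta>}"
      unfolding a_def by (intro measure_mono_fmeasurable) (auto simp: B_def A(1))
    also have "\<dots> = \<delta>" using \<delta> by (simp add: algebra_simps)
    finally show ?thesis .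
  qed
  define w where "w = (\<lambda>k l. a k / (pi * ((real k - real l + 1) * \<delta>)))"
  have w0: "w k l \<ge> 0" if "l < k" for k l
    using that \<delta> by (auto simp: w_def a_def)
  have ptw: "w k l \<le> norm (m_L1 (B k) t)" if "l < k" "t \<in> B l" for k l t
  proof -
    have "(real l + 1) * \<delta> \<le> real k * \<delta>" using that(1) \<delta> by (intro mult_right_mono) auto
    then have "t < -1 + real k * \<delta>" using that(2) by (auto simp: B_def)
    moreover have "B k \<subseteq> {-1 + real k * \<delta>..<1}" using A(2) by (auto simp: B_def)
    moreover have "B k \<subseteq> {..t + (real k - real l + 1) * \<delta>}"
      using that(2) by (auto simp: B_def algebra_simps)
    moreover have "(real k - real l + 1) * \<delta> > 0" using that(1) \<delta> by simp
    ultimately show ?thesis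
      unfolding w_def a_def m_L1_def
      by (intro norm_finite_hilbert_transform_indicator_ge) auto
  qed
  have L1: "ennreal (\<Sum>l<k. w k l * a l) \<le> L1_norm (m_L1 (B k))" for k
  proof -
    have "ennreal (\<Sum>l<k. w k l * a l) = (\<Sum>l<k. ennreal (w k l) * emeasure mu (B l))"
      unfolding emu using w0
      by (subst sum_ennreal[symmetric]) (auto simp: a_def ennreal_mult intro!: sum.cong)
    also have "\<dots> = (\<integral>\<^sup>+ t. (\<Sum>l<k. ennreal (w k l) * indicator (B l) t) \<partial>mu)"
      using Bmu by (subst nn_integral_sum) (auto simp: nn_integral_cmult_indicator)
    also have "\<dots> \<le> L1_norm (m_L1 (B k))"
      unfolding L1_norm_def
    proof (rule nn_integral_mono)
      fix t
      show "(\<Sum>l<k. ennreal (w k l) * indicator (B l) t) \<le> ennreal (norm (m_L1 (B k) t))"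
      proof (cases "\<exists>l<k. t \<in> B l")
        case True
        then obtain l where l: "l < k" "t \<in> B l" by blast
        have "(\<Sum>j<k. ennreal (w k j) * indicator (B j) t) = (\<Sum>j\<in>{l}. ennreal (w k j) * indicator (B j) t)"
          using l disj by (intro sum.mono_neutral_right) (auto split: split_indicator)
        then show ?thesis using l ptw[OF l] by (simp add: ennreal_leI)
      next
        case False
        then have "(\<Sum>l<k. ennreal (w k l) * indicator (B l) t) = 0"
          by (intro sum.neutral) auto
        then show ?thesis by simp
      qed
    qed
    finally show ?thesis .
  qed
  \<comment> \<open>Empty pieces are not blocks of a partition; they have \<open>a k = 0\<close> and can be dropped.\<close>
  define K where "K = {k. k < n \<and> B k \<noteq> {}}"
  have inj: "inj_on B K" using disj unfolding K_def inj_on_def by blast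
  have finK: "finite K" by (simp add: K_def)
  have part: "partition_on A (B ` K)"
  proof (rule partition_onI)
    show "\<Union> (B ` K) = A" using UB by (auto simp: K_def)
    show "disjnt p q" if pq: "p \<in> B ` K" "q \<in> B ` K" "p \<noteq> q" for p q
    proof -
      obtain i j where "p = B i" "q = B j" using pq by blast
      then show ?thesis using disj[of _ i j] pq(3) unfolding disjnt_def by blast
    qed
    show "{} \<notin> B ` K" by (auto simp: K_def)
  qed
  have "ennreal (1 / (pi * \<delta>) * (\<Sum>k<n. \<Sum>l<k. a k * a l / (real k - real l + 1)))
      = ennreal (\<Sum>k<n. \<Sum>l<k. w k l * a l)"
    by (simp add: sum_distrib_left w_def mult_ac)
  also have "\<dots> = ennreal (\<Sum>k\<in>K. \<Sum>l<k. w k l * a l)"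
    by (intro arg_cong[of _ _ ennreal] sum.mono_neutral_right) (auto simp: K_def w_def a_def)
  also have "\<dots> = (\<Sum>k\<in>K. ennreal (\<Sum>l<k. w k l * a l))"
    using w0 by (intro sum_ennreal[symmetric] sum_nonneg mult_nonneg_nonneg) (auto simp: a_def)
  also have "\<dots> \<le> (\<Sum>k\<in>K. L1_norm (m_L1 (B k)))"
    by (intro sum_mono L1)
  also have "\<dots> = (\<Sum>C\<in>B ` K. L1_norm (m_L1 C))"
    by (simp add: sum.reindex[OF inj])
  also have "\<dots> \<le> variation mu L1_norm m_L1 A"
    unfolding variation_def using finK part Bmu by (intro SUP_upper) auto
  finally show "ennreal (1 / (pi * \<delta>) * (\<Sum>k<n. \<Sum>l<k. a k * a l / (real k - real l + 1)))
      \<le> variation mu L1_norm m_L1 A" .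
qed

lemma variation_ge_linear:
  fixes A :: "real set"
  assumes A: "A \<in> sets borel" "A \<subseteq> {-1<..<1}"
  shows "ennreal (((1 + real m / 2) * (measure lborel A)\<^sup>2 / 2 - measure lborel A) / (2 * pi))
      \<le> variation mu L1_norm m_L1 A"
proof -
  define n :: nat where "n = 2 ^ m"
  define \<delta> where "\<delta> = 2 / real n"
  define a where "a = (\<lambda>k::nat. measure lborel (A \<inter> {-1 + real k * \<delta>..< -1 + (real k + 1) * \<delta>}))"
  define Q where "Q = (\<Sum>k<n. \<Sum>l<k. a k * a l / (real k - real l + 1))"
  define s where "s = measure lborel A"
  have n: "n > 0" by (simp add: n_def)
  then have \<delta>: "\<delta> > 0" by (simp add: \<delta>_def)
  note * = variation_ge_quadratic_form[OF A n, folded \<delta>_def, folded a_def]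
  have sum_a: "(\<Sum>k<n. a k) = s" using *(2) by (simp add: s_def a_def)
  have "(\<Sum>k<n. (a k)\<^sup>2) \<le> (\<Sum>k<n. \<delta> * a k)"
    unfolding power2_eq_square using *(3) by (intro sum_mono mult_right_mono) (auto simp: a_def)
  also have "\<dots> = \<delta> * s" by (simp add: sum_a flip: sum_distrib_left)
  finally have diag: "(\<Sum>k<n. (a k)\<^sup>2) \<le> \<delta> * s" .
  have "(1 + real m / 2) * s\<^sup>2 / 2 ^ m \<le> (\<Sum>k<n. (a k)\<^sup>2) + 2 * Q"
    using dyadic_quadratic_form_lower_bound[of a m] unfolding Q_def sum_a[symmetric] n_def
    by (simp add: a_def)
  moreover have "(1 + real m / 2) * s\<^sup>2 / 2 ^ m = \<delta> * ((1 + real m / 2) * s\<^sup>2 / 2)"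
    by (simp add: \<delta>_def n_def)
  ultimately have "\<delta> * ((1 + real m / 2) * s\<^sup>2 / 2 - s) \<le> 2 * Q"
    using diag by (subst right_diff_distrib) linarith
  then have "(1 + real m / 2) * s\<^sup>2 / 2 - s \<le> 2 * Q / \<delta>"
    using \<delta> by (simp add: pos_le_divide_eq mult.commute)
  then have "((1 + real m / 2) * s\<^sup>2 / 2 - s) / (2 * pi) \<le> 2 * Q / \<delta> / (2 * pi)"
    by (intro divide_right_mono) auto
  then have "((1 + real m / 2) * s\<^sup>2 / 2 - s) / (2 * pi) \<le> 1 / (pi * \<delta>) * Q"
    by (simp add: mult.commute)
  then show ?thesis
    using *(1) unfolding Q_def s_def a_def by (meson ennreal_leI order_trans)
qed

theorem theorem3p4:
  fixes A :: "real set"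
  assumes "A \<in> sets mu" and "emeasure mu A > 0"
  shows "variation mu L1_norm m_L1 A = \<infinity>"
proof (rule ccontr)
  assume "variation mu L1_norm m_L1 A \<noteq> \<infinity>"
  then obtain r where r: "0 \<le> r" "variation mu L1_norm m_L1 A = ennreal r"
    by (cases "variation mu L1_norm m_L1 A") auto
  have A: "A \<in> sets borel" "A \<subseteq> {-1<..<1}"
    using assms(1) by (auto simp: mu_def sets_restrict_space_iff)
  have "emeasure lborel A > 0"
    using assms(2) A by (simp add: mu_def emeasure_restrict_space)
  moreover have "emeasure lborel A < \<infinity>"
    using A(2) by (intro emeasure_bounded_finite bounded_subset[OF bounded_closed_interval[of "-1" 1]]) force
  ultimately have s: "measure lborel A > 0"
    by (simp add: measure_def enn2real_positive_iff less_top)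
  define s where "s = measure lborel A"
  obtain m :: nat where m: "(2 * pi * r + s) * 4 / s\<^sup>2 < real m"
    using reals_Archimedean2 by blast
  have "((1 + real m / 2) * s\<^sup>2 / 2 - s) / (2 * pi) \<le> r"
    using variation_ge_linear[OF A, of m] r by (simp add: s_def)
  then have "(1 + real m / 2) * s\<^sup>2 / 2 - s \<le> 2 * pi * r"
    by (simp add: field_simps)
  moreover have "(2 * pi * r + s) * 4 < real m * s\<^sup>2"
    using m s by (simp add: s_def field_simps)
  moreover have "s\<^sup>2 \<ge> 0" by simp
  ultimately show False by (simp add: field_simps)
qed

end
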